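(* Consider an $[[n,k]]$ CSS code with logical Pauli vectors $l_{i,X},l_{i,Z}\in\mathbb F_2^n$, $i=1,\dots,k$. The following (products of) symplectic transvections are symplectic matrices representing the indicated logical gates (for $i,j\in\{1,\dots,k\}$, with $i\neq j$ in (3), (4)): (1) the single-qubit logical Phase gate on the $i$-th logical qubit: $\overline S_i\equiv T_{[0,l_{i,Z}]}$; (2) the single-qubit logical Hadamard gate on the $i$-th logical qubit: $\overline H_i\equiv T_{[l_{i,X},l_{i,Z}]}$; (3) the two-qubit logical CNOT gate with control the $i$-th and target the $j$-th logical qubit: $\overline{CNOT}_{i\to j}\equiv T_{[l_{j,X},0]}\,T_{[l_{j,X},l_{i,Z}]}\,T_{[0,l_{i,Z}]}$; (4) the two-qubit logical CZ gate between the $i$-th and $j$-th logical qubits: $\overline{CZ}_{i,j}\equiv T_{[0,l_{i,Z}]}\,T_{[0,l_{i,Z}+l_{j,Z}]}\,T_{[0,l_{j,Z}]}$.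
   Context: All vectors are row vectors over $\mathbb F_2$. Let $\Omega=\begin{bmatrix}0 & I_n \\ I_n & 0\end{bmatrix}$ and $(x,y)_s=x\Omega y^{\top}$ on $\mathbb F_2^{2n}$; $Sp(2n,\mathbb F_2)=\{F:F\Omega F^{\top}=\Omega\}$. For $x\in\mathbb F_2^{2n}$ the symplectic transvection is $T_x(y)=y+(y,x)_sx$, i.e. right multiplication of row vectors by the matrix $I+\Omega x^{\top}x$ (also denoted $T_x$). An $[[n,k]]$ CSS code is given by binary matrices $H_X$ ($m_X\times n$) and $H_Z$ ($m_Z\times n$) with $H_XH_Z^{\top}=0$, with linearly independent rows in each and $m_X+m_Z=n-k$. Stabilizer generators correspond to the vectors $[H_X(i,:),0]$ and $[0,H_Z(i,:)]$ in $\mathbb F_2^{2n}$ (with $[a,b]$ representing, up to phase, the Pauli operator $X^{a_1}Z^{b_1}\otimes\cdots\otimes X^{a_n}Z^{b_n}$). The vectors $l_{i,X}\in\ker H_Z$ represent a basis of $\ker(H_Z)/\mathrm{Im}(H_X^{\top})$, the vectors $l_{i,Z}\in\ker H_X$ represent a basis of $\ker(H_X)/\mathrm{Im}(H_Z^{\top})$, and $l_{i,X}l_{j,Z}^{\top}=\delta_{ij}$. The logical Paulis $\overline X_i,\overline Z_i$ correspond to $[l_{i,X},0]$ and $[0,l_{i,Z}]$. "$g\equiv F$" means: $F\in Sp(2n,\mathbb F_2)$, right multiplication by $F$ fixes every stabilizer vector, and it acts on the logical Pauli vectors as $g$ acts (modulo phases) on logical Paulis by conjugation, all logical Paulis not listed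 being fixed, namely: $\overline S_i$: $\overline X_i\mapsto\overline X_i\overline Z_i$; $\overline H_i$: $\overline X_i\leftrightarrow\overline Z_i$; $\overline{CNOT}_{i\to j}$: $\overline X_i\mapsto\overline X_i\overline X_j$, $\overline Z_j\mapsto\overline Z_i\overline Z_j$; $\overline{CZ}_{i,j}$: $\overline X_i\mapsto\overline X_i\overline Z_j$, $\overline X_j\mapsto\overline Z_i\overline X_j$. *)

theory Defs
  imports "HOL-Library.Z2" "Jordan_Normal_Form.VS_Connect" "Jordan_Normal_Form.Matrix_Kernel"
begin

text \<open>
  The field with two elements is the type \<^typ>\<open>bit\<close>.  Row vectors over it are of type
  \<^typ>\<open>bit vec\<close>, and \<open>[a, b]\<close> is \<^term>\<open>a @\<^sub>v b\<close>.
\<close>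

definition vec_mult_mat :: "bit vec \<Rightarrow> bit mat \<Rightarrow> bit vec" (infixl \<open>v*\<close> 70) where
  "x v* A = A\<^sup>T *\<^sub>v x"

definition Omega :: "nat \<Rightarrow> bit mat" where
  "Omega n = four_block_mat (0\<^sub>m n n) (1\<^sub>m n) (1\<^sub>m n) (0\<^sub>m n n)"

definition symp_form :: "nat \<Rightarrow> bit vec \<Rightarrow> bit vec \<Rightarrow> bit" where
  "symp_form n x y = (x v* Omega n) \<bullet> y"

definition Sp :: "nat \<Rightarrow> bit mat set" where
  "Sp n = {F \<in> carrier_mat (2 * n) (2 * n). F * Omega n * F\<^sup>T = Omega n}"

text \<open>
  \<open>transvection n x\<close> is the matrix \<open>I + \<Omega> x\<^sup>T x\<close> for the row vector \<open>x\<close>.  Matrices act from the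
  right, so in a product of transvections the leftmost factor acts first.
\<close>

definition transvection :: "nat \<Rightarrow> bit vec \<Rightarrow> bit mat" where
  "transvection n x = 1\<^sub>m (2 * n) + Omega n * (mat_of_row x)\<^sup>T * mat_of_row x"

lemma Omega_carrier: "Omega n \<in> carrier_mat (2 * n) (2 * n)"
  unfolding Omega_def mult_2 by (rule four_block_carrier_mat) auto

lemma transvection_apply:
  assumes x: "x \<in> carrier_vec (2 * n)" and y: "y \<in> carrier_vec (2 * n)"
  shows "y v* transvection n x = y + symp_form n y x \<cdot>\<^sub>v x"
proof -
  let ?r = "mat_of_row x"
  let ?A = "Omega n * ?r\<^sup>T"
  have O: "Omega n \<in> carrier_mat (2 * n) (2 * n)" by (rule Omega_carrier)
  have r: "?r \<in> carrier_mat 1 (2 * n)" using x by simp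
  have A: "?A \<in> carrier_mat (2 * n) 1" using O r by auto
  have col: "col ?A 0 = Omega n *\<^sub>v x"
    using O r by (subst col_mult2[where nr = "2 * n" and n = "2 * n" and nc = 1]) auto
  have form: "symp_form n y x = (Omega n *\<^sub>v x) \<bullet> y"
    unfolding symp_form_def vec_mult_mat_def
    using O x y by (subst transpose_vec_mult_scalar[of _ "2 * n" "2 * n"])
      (auto intro!: comm_scalar_prod)
  have Ay: "?A\<^sup>T *\<^sub>v y = vec 1 (\<lambda>_. symp_form n y x)"
    using A col by (intro eq_vecI) (auto simp: form)
  have ry: "?r\<^sup>T *\<^sub>v vec 1 (\<lambda>_. c) = c \<cdot>\<^sub>v x" for c
    using x by (intro eq_vecI) (auto simp: scalar_prod_def)
  have "(transvection n x)\<^sup>T = 1\<^sub>m (2 * n) + (?A * ?r)\<^sup>T"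
    unfolding transvection_def using A r
    by (subst transpose_add[where nr = "2 * n" and nc = "2 * n"]) auto
  also have "(?A * ?r)\<^sup>T = ?r\<^sup>T * ?A\<^sup>T"
    using A r by (rule transpose_mult)
  finally have "y v* transvection n x = (1\<^sub>m (2 * n) + ?r\<^sup>T * ?A\<^sup>T) *\<^sub>v y"
    unfolding vec_mult_mat_def by simp
  also have "\<dots> = 1\<^sub>m (2 * n) *\<^sub>v y + (?r\<^sup>T * ?A\<^sup>T) *\<^sub>v y"
    using A r y by (intro add_mult_distrib_mat_vec[where nr = "2 * n" and nc = "2 * n"]) auto
  also have "(?r\<^sup>T * ?A\<^sup>T) *\<^sub>v y = ?r\<^sup>T *\<^sub>v (?A\<^sup>T *\<^sub>v y)"
    using A r y by (intro assoc_mult_mat_vec[where n\<^sub>1 = "2 * n" and n\<^sub>2 = 1 and n\<^sub>3 = "2 * n"]) auto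
  finally show ?thesis using y by (simp only: Ay ry one_mult_mat_vec)
qed

text \<open>
  An \<open>[[n, k]]\<close> CSS code.  The rows form a linearly independent family; \<open>lin_dep\<close> only sees the set
  of rows, hence the additional distinctness.
\<close>

definition lin_indpt_rows :: "nat \<Rightarrow> bit mat \<Rightarrow> bool" where
  "lin_indpt_rows n H \<longleftrightarrow>
     distinct (rows H) \<and> \<not> LinearCombinations.module.lin_dep class_ring (module_vec TYPE(bit) n) (set (rows H))"

definition css_code :: "nat \<Rightarrow> nat \<Rightarrow> bit mat \<Rightarrow> bit mat \<Rightarrow> bool" where
  "css_code n k HX HZ \<longleftrightarrow>
     dim_col HX = n \<and> dim_col HZ = n \<and>
     HX * HZ\<^sup>T = 0\<^sub>m (dim_row HX) (dim_row HZ) \<and>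
     lin_indpt_rows n HX \<and> lin_indpt_rows n HZ \<and>
     dim_row HX + dim_row HZ + k = n"

definition mat_image :: "bit mat \<Rightarrow> bit vec set" where
  "mat_image A = (\<lambda>v. A *\<^sub>v v) ` carrier_vec (dim_col A)"

text \<open>
  For subspaces \<open>W \<subseteq> V\<close> of the space of vectors of length \<open>n\<close>: the cosets of \<open>l 1, \<dots>, l k\<close> form a
  basis of the quotient \<open>V / W\<close>, i.e. they are linearly independent and spanning modulo \<open>W\<close>.
\<close>

definition represents_quotient_basis ::
    "nat \<Rightarrow> nat \<Rightarrow> (nat \<Rightarrow> bit vec) \<Rightarrow> bit vec set \<Rightarrow> bit vec set \<Rightarrow> bool" where
  "represents_quotient_basis n k l V W \<longleftrightarrow>
     (\<forall>i\<in>{1..k}. l i \<in> V) \<and>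
     (\<forall>c. finsum_vec TYPE(bit) n (\<lambda>i. c i \<cdot>\<^sub>v l i) {1..k} \<in> W \<longrightarrow> (\<forall>i\<in>{1..k}. c i = 0)) \<and>
     (\<forall>v\<in>V. \<exists>c. v - finsum_vec TYPE(bit) n (\<lambda>i. c i \<cdot>\<^sub>v l i) {1..k} \<in> W)"

definition logical_pauli_vectors ::
    "nat \<Rightarrow> nat \<Rightarrow> bit mat \<Rightarrow> bit mat \<Rightarrow> (nat \<Rightarrow> bit vec) \<Rightarrow> (nat \<Rightarrow> bit vec) \<Rightarrow> bool" where
  "logical_pauli_vectors n k HX HZ lX lZ \<longleftrightarrow>
     represents_quotient_basis n k lX (mat_kernel HZ) (mat_image HX\<^sup>T) \<and>
     represents_quotient_basis n k lZ (mat_kernel HX) (mat_image HZ\<^sup>T) \<and>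
     (\<forall>i\<in>{1..k}. \<forall>j\<in>{1..k}. lX i \<bullet> lZ j = (if i = j then 1 else 0))"

text \<open>
  All vectors of stabilizer elements, i.e. the span of the generators \<open>[H\<^sub>X(i,:), 0]\<close> and
  \<open>[0, H\<^sub>Z(i,:)]\<close>.
\<close>

definition stabilizer_vectors :: "nat \<Rightarrow> bit mat \<Rightarrow> bit mat \<Rightarrow> bit vec set" where
  "stabilizer_vectors n HX HZ =
     LinearCombinations.module.span class_ring (module_vec TYPE(bit) (2 * n))
       ({row HX i @\<^sub>v 0\<^sub>v n | i. i < dim_row HX} \<union> {0\<^sub>v n @\<^sub>v row HZ i | i. i < dim_row HZ})"

definition logical_X :: "nat \<Rightarrow> (nat \<Rightarrow> bit vec) \<Rightarrow> nat \<Rightarrow> bit vec" where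
  "logical_X n lX i = lX i @\<^sub>v 0\<^sub>v n"

definition logical_Z :: "nat \<Rightarrow> (nat \<Rightarrow> bit vec) \<Rightarrow> nat \<Rightarrow> bit vec" where
  "logical_Z n lZ i = 0\<^sub>v n @\<^sub>v lZ i"

text \<open>\<open>CNOT i j\<close> has control \<open>i\<close> and target \<open>j\<close>.\<close>

datatype logical_gate = Phase nat | Hadamard nat | CNOT nat nat | CZ nat nat

text \<open>
  Images of the logical Pauli operators \<open>X\<^sub>m\<close> and \<open>Z\<^sub>m\<close> under conjugation by a gate, modulo phases,
  where \<open>X\<close> and \<open>Z\<close> give the vectors of the logical Paulis.  Products of Paulis are sums of vectors.
\<close>

fun gate_on_X ::
    "logical_gate \<Rightarrow> (nat \<Rightarrow> bit vec) \<Rightarrow> (nat \<Rightarrow> bit vec) \<Rightarrow> nat \<Rightarrow> bit vec" where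
  "gate_on_X (Phase i) X Z m = (if m = i then X i + Z i else X m)"
| "gate_on_X (Hadamard i) X Z m = (if m = i then Z i else X m)"
| "gate_on_X (CNOT i j) X Z m = (if m = i then X i + X j else X m)"
| "gate_on_X (CZ i j) X Z m =
     (if m = i then X i + Z j else if m = j then Z i + X j else X m)"

fun gate_on_Z ::
    "logical_gate \<Rightarrow> (nat \<Rightarrow> bit vec) \<Rightarrow> (nat \<Rightarrow> bit vec) \<Rightarrow> nat \<Rightarrow> bit vec" where
  "gate_on_Z (Phase i) X Z m = Z m"
| "gate_on_Z (Hadamard i) X Z m = (if m = i then X i else Z m)"
| "gate_on_Z (CNOT i j) X Z m = (if m = j then Z i + Z j else Z m)"
| "gate_on_Z (CZ i j) X Z m = Z m"

text \<open>The relation \<open>g \<equiv> F\<close>.\<close>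

definition represents_gate ::
    "nat \<Rightarrow> nat \<Rightarrow> bit mat \<Rightarrow> bit mat \<Rightarrow> (nat \<Rightarrow> bit vec) \<Rightarrow> (nat \<Rightarrow> bit vec) \<Rightarrow>
     logical_gate \<Rightarrow> bit mat \<Rightarrow> bool" where
  "represents_gate n k HX HZ lX lZ g F \<longleftrightarrow>
     F \<in> Sp n \<and>
     (\<forall>s\<in>stabilizer_vectors n HX HZ. s v* F = s) \<and>
     (\<forall>m\<in>{1..k}.
        logical_X n lX m v* F = gate_on_X g (logical_X n lX) (logical_Z n lZ) m \<and>
        logical_Z n lZ m v* F = gate_on_Z g (logical_X n lX) (logical_Z n lZ) m)"

end

theory Submission
  imports Defs
begin

text \<open>
  \<open>T\<^sub>x\<close> preserves the symplectic form because \<open>(x, x)\<^sub>s = 0\<close> and the two cross terms cancel in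
  characteristic 2.  For \<open>x = [a, b]\<close> with \<open>a \<in> ker H\<^sub>Z\<close> and \<open>b \<in> ker H\<^sub>X\<close>, every stabilizer vector
  is orthogonal to \<open>x\<close> and hence fixed by \<open>T\<^sub>x\<close>.  The images of the logical Pauli vectors only
  involve the numbers \<open>l\<^sub>i\<^sub>,\<^sub>X \<bullet> l\<^sub>j\<^sub>,\<^sub>Z\<close>, because each logical Pauli vector has a zero \<open>X\<close>- or
  \<open>Z\<close>-part.
\<close>

section \<open>Vectors over the two-element field and the right action of matrices\<close>

lemma bit_vec_add_self:
  fixes v :: "bit vec"
  assumes "v \<in> carrier_vec n"
  shows "v + v = 0\<^sub>v n"
  using assms by (intro eq_vecI) auto

lemma bit_vec_add_self_right:
  fixes v w :: "bit vec"
  assumes "v \<in> carrier_vec n" "w \<in> carrier_vec n"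
  shows "v + w + w = v"
  using assms by (intro eq_vecI) (auto simp: add.assoc)

lemma mult_mat_zero_vec:
  fixes A :: "'a :: semiring_0 mat"
  assumes "A \<in> carrier_mat nr nc"
  shows "A *\<^sub>v 0\<^sub>v nc = 0\<^sub>v nr"
  using assms by (intro eq_vecI) auto

lemma zero_smult_vec:
  assumes "v \<in> carrier_vec n"
  shows "(0 :: 'a :: mult_zero) \<cdot>\<^sub>v v = 0\<^sub>v n"
  using assms by (intro eq_vecI) auto

lemma vec_mult_mat_carrier:
  assumes "F \<in> carrier_mat m m'" "y \<in> carrier_vec m"
  shows "y v* F \<in> carrier_vec m'"
  using assms unfolding vec_mult_mat_def by (intro mult_mat_vec_carrier) auto

text \<open>Transposition reverses products, so with row vectors the left factor acts first.\<close>

lemma vec_mult_mat_times: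
  assumes "A \<in> carrier_mat m m" "B \<in> carrier_mat m m" "y \<in> carrier_vec m"
  shows "y v* (A * B) = (y v* A) v* B"
  using assms unfolding vec_mult_mat_def
  by (simp add: transpose_mult[OF assms(1,2)] assoc_mult_mat_vec[of _ m m _ m])

lemma vec_mult_mat_unit_vec:
  assumes "F \<in> carrier_mat m m'" "i < m"
  shows "unit_vec m i v* F = row F i"
  using assms unfolding vec_mult_mat_def
  by (intro eq_vecI) auto

section \<open>The symplectic form on X- and Z-halves\<close>

lemma symp_form_append:
  assumes "a \<in> carrier_vec n" "b \<in> carrier_vec n" "c \<in> carrier_vec n" "d \<in> carrier_vec n"
  shows "symp_form n (a @\<^sub>v b) (c @\<^sub>v d) = a \<bullet> d + b \<bullet> c"
proof -
  have T: "(Omega n)\<^sup>T = four_block_mat (0\<^sub>m n n) (1\<^sub>m n) (1\<^sub>m n) (0\<^sub>m n n)"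
    unfolding Omega_def by (subst transpose_four_block_mat[of _ n n _ n _ n]) auto
  \<comment> \<open>Multiplication by \<open>Omega n\<close> swaps the two halves.\<close>
  have "(a @\<^sub>v b) v* Omega n = b @\<^sub>v a"
    unfolding vec_mult_mat_def T using assms
    by (subst four_block_mat_mult_vec[of _ n n _ n _ n]) auto
  then have "symp_form n (a @\<^sub>v b) (c @\<^sub>v d) = b \<bullet> c + a \<bullet> d"
    unfolding symp_form_def using assms by (simp add: scalar_prod_append[of _ n _ n])
  then show ?thesis by (simp only: add.commute)
qed

lemma vec_append_cases:
  assumes "x \<in> carrier_vec (2 * n)"
  obtains a b where "a \<in> carrier_vec n" "b \<in> carrier_vec n" "x = a @\<^sub>v b"
proof
  show "x = vec_first x n @\<^sub>v vec_last x n"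
    using assms vec_first_last_append[of x n n] by (simp add: mult_2)
qed auto

text \<open>For halves \<open>a\<close> and \<open>b\<close> the value is twice
  \<open>a \<bullet> b\<close>, which is 0 in characteristic 2.\<close>

lemma symp_form_self:
  assumes "x \<in> carrier_vec (2 * n)"
  shows "symp_form n x x = 0"
proof -
  obtain a b where "a \<in> carrier_vec n" "b \<in> carrier_vec n" "x = a @\<^sub>v b"
    using assms by (rule vec_append_cases)
  then show ?thesis by (simp add: symp_form_append comm_scalar_prod[of b n a])
qed

lemma symp_form_commute:
  assumes "x \<in> carrier_vec (2 * n)" "y \<in> carrier_vec (2 * n)"
  shows "symp_form n x y = symp_form n y x"
proof -
  obtain a b where x: "a \<in> carrier_vec n" "b \<in> carrier_vec n" "x = a @\<^sub>v b"
    using assms(1) by (rule vec_append_cases)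
  obtain c d where y: "c \<in> carrier_vec n" "d \<in> carrier_vec n" "y = c @\<^sub>v d"
    using assms(2) by (rule vec_append_cases)
  show ?thesis
    using x y
    by (simp only: symp_form_append comm_scalar_prod[of c n b] comm_scalar_prod[of d n a] add.commute)
qed

text \<open>The argument \<open>y + c \<cdot>\<^sub>v z\<close> has the shape of an image under a
  transvection, so one rule serves both for additivity and for scaling.\<close>

lemma symp_form_add_smult_right:
  assumes "x \<in> carrier_vec (2 * n)" "y \<in> carrier_vec (2 * n)" "z \<in> carrier_vec (2 * n)"
  shows "symp_form n x (y + c \<cdot>\<^sub>v z) = symp_form n x y + c * symp_form n x z"
proof -
  have "x v* Omega n \<in> carrier_vec (2 * n)"
    using Omega_carrier assms(1) by (rule vec_mult_mat_carrier)
  then show ?thesis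
    unfolding symp_form_def using assms by (simp add: scalar_prod_add_distrib[of _ "2 * n"])
qed

lemma symp_form_add_smult_left:
  assumes "x \<in> carrier_vec (2 * n)" "y \<in> carrier_vec (2 * n)" "z \<in> carrier_vec (2 * n)"
  shows "symp_form n (y + c \<cdot>\<^sub>v z) x = symp_form n y x + c * symp_form n z x"
  using assms
  by (simp add: symp_form_commute[of _ n x] symp_form_add_smult_right)

section \<open>Transvections and the symplectic group\<close>

lemma transvection_carrier:
  assumes "x \<in> carrier_vec (2 * n)"
  shows "transvection n x \<in> carrier_mat (2 * n) (2 * n)"
proof -
  have "mat_of_row x \<in> carrier_mat 1 (2 * n)" using assms by simp
  then show ?thesis unfolding transvection_def using Omega_carrier[of n] by auto
qed

lemma symp_form_transvection:
  assumes x: "x \<in> carrier_vec (2 * n)" and y: "y \<in> carrier_vec (2 * n)" and z: "z \<in> carrier_vec (2 * n)"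
  shows "symp_form n (y v* transvection n x) (z v* transvection n x) = symp_form n y z"
proof -
  \<comment> \<open>Of the four terms of the bilinear expansion, the one with
    \<open>symp_form n x x\<close> is already dropped; the last two are equal and cancel.\<close>
  have "symp_form n (y v* transvection n x) (z v* transvection n x)
    = symp_form n y z + symp_form n z x * symp_form n y x + symp_form n y x * symp_form n z x"
    using x y z
    by (simp only: transvection_apply symp_form_add_smult_left symp_form_add_smult_right
        symp_form_self symp_form_commute[of x n z] add_carrier_vec smult_carrier_vec mult_zero_right
        add_0_right distrib_left mult.commute[of "symp_form n z x"] add.assoc)
  then show ?thesis by auto
qed

text \<open>The entries of \<open>F * Omega n * F\<^sup>T\<close> are the form values on pairs of
  rows of \<open>F\<close>, and these rows are the images of the unit vectors.\<close>

lemma Sp_I: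
  assumes F: "F \<in> carrier_mat (2 * n) (2 * n)"
    and form: "\<And>y z. y \<in> carrier_vec (2 * n) \<Longrightarrow> z \<in> carrier_vec (2 * n) \<Longrightarrow>
      symp_form n (y v* F) (z v* F) = symp_form n y z"
  shows "F \<in> Sp n"
proof -
  \<comment> \<open>Stated for arbitrary \<open>G\<close>, because it is needed both for
    \<open>F\<close> and for the identity matrix.\<close>
  have entry: "(G * Omega n * G\<^sup>T) $$ (i, j) =
      symp_form n (unit_vec (2 * n) i v* G) (unit_vec (2 * n) j v* G)"
    if G: "G \<in> carrier_mat (2 * n) (2 * n)" and i: "i < 2 * n" and j: "j < 2 * n" for G i j
  proof -
    have "row (G * Omega n) i = unit_vec (2 * n) i v* (G * Omega n)"
      using G Omega_carrier[of n] i by (intro vec_mult_mat_unit_vec[symmetric]) auto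
    also have "\<dots> = (unit_vec (2 * n) i v* G) v* Omega n"
      using G Omega_carrier[of n] by (intro vec_mult_mat_times) auto
    finally have "row (G * Omega n) i \<bullet> row G j
        = symp_form n (unit_vec (2 * n) i v* G) (unit_vec (2 * n) j v* G)"
      unfolding symp_form_def using vec_mult_mat_unit_vec[OF G j] by simp
    then show ?thesis
      using G Omega_carrier[of n] i j by (subst index_mult_mat(1)) auto
  qed
  have unit: "unit_vec (2 * n) i v* 1\<^sub>m (2 * n) = unit_vec (2 * n) i" for i
    unfolding vec_mult_mat_def by simp
  \<comment> \<open>Writing \<open>Omega n\<close> with identity factors lets \<open>entry\<close>
    compute both sides.\<close>
  have "F * Omega n * F\<^sup>T = 1\<^sub>m (2 * n) * Omega n * (1\<^sub>m (2 * n))\<^sup>T"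
  proof (rule eq_matI)
    fix i j
    assume "i < dim_row (1\<^sub>m (2 * n) * Omega n * (1\<^sub>m (2 * n))\<^sup>T)"
      and "j < dim_col (1\<^sub>m (2 * n) * Omega n * (1\<^sub>m (2 * n))\<^sup>T)"
    then have "i < 2 * n" "j < 2 * n" by auto
    then show "(F * Omega n * F\<^sup>T) $$ (i, j) = (1\<^sub>m (2 * n) * Omega n * (1\<^sub>m (2 * n))\<^sup>T) $$ (i, j)"
      by (simp only: entry[OF F] entry[OF one_carrier_mat] form[OF unit_vec_carrier unit_vec_carrier] unit)
  qed (use F in auto)
  then show ?thesis
    unfolding Sp_def using F Omega_carrier[of n] by simp
qed

text \<open>Converse of \<open>Sp_I\<close>: moving \<open>F\<close> across the scalar product makes
  \<open>F * Omega n * F\<^sup>T\<close> appear on the left. With both directions, closure under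
  products is just composition of form-preserving maps.\<close>

lemma symp_form_Sp:
  assumes F: "F \<in> Sp n" and y: "y \<in> carrier_vec (2 * n)" and z: "z \<in> carrier_vec (2 * n)"
  shows "symp_form n (y v* F) (z v* F) = symp_form n y z"
proof -
  have c: "F \<in> carrier_mat (2 * n) (2 * n)" and eq: "F * Omega n * F\<^sup>T = Omega n"
    using F unfolding Sp_def by auto
  note O = Omega_carrier[of n]
  have "symp_form n (y v* F) (z v* F) = (y v* (F * Omega n)) \<bullet> (F\<^sup>T *\<^sub>v z)"
    unfolding symp_form_def using vec_mult_mat_times[OF c O y] by (simp add: vec_mult_mat_def)
  also have "\<dots> = (F *\<^sub>v (y v* (F * Omega n))) \<bullet> z"
    using c O y z vec_mult_mat_carrier[of "F * Omega n" "2 * n" "2 * n" y]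
    by (metis mult_carrier_mat transpose_carrier_mat transpose_transpose transpose_vec_mult_scalar)
  also have "F *\<^sub>v (y v* (F * Omega n)) = (y v* (F * Omega n)) v* F\<^sup>T"
    unfolding vec_mult_mat_def by simp
  also have "\<dots> = y v* Omega n"
    using vec_mult_mat_times[of "F * Omega n" "2 * n" "F\<^sup>T" y] c O y eq by simp
  finally show ?thesis unfolding symp_form_def .
qed

lemma transvection_in_Sp:
  assumes "x \<in> carrier_vec (2 * n)"
  shows "transvection n x \<in> Sp n"
  using assms by (intro Sp_I transvection_carrier symp_form_transvection)

lemma Sp_mult:
  assumes "F \<in> Sp n" "G \<in> Sp n"
  shows "F * G \<in> Sp n"
proof (rule Sp_I)
  have c: "F \<in> carrier_mat (2 * n) (2 * n)" "G \<in> carrier_mat (2 * n) (2 * n)"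
    using assms unfolding Sp_def by auto
  then show "F * G \<in> carrier_mat (2 * n) (2 * n)" by simp
  fix y z :: "bit vec"
  assume "y \<in> carrier_vec (2 * n)" "z \<in> carrier_vec (2 * n)"
  then show "symp_form n (y v* (F * G)) (z v* (F * G)) = symp_form n y z"
    using c assms by (simp add: vec_mult_mat_times symp_form_Sp vec_mult_mat_carrier)
qed

text \<open>The working formula for the gates: a transvection acts on both halves with the same
  coefficient, given by two scalar products.\<close>

lemma transvection_apply_append:
  assumes "a \<in> carrier_vec n" "b \<in> carrier_vec n" "c \<in> carrier_vec n" "d \<in> carrier_vec n"
  shows "(c @\<^sub>v d) v* transvection n (a @\<^sub>v b) =
    (c + (c \<bullet> b + d \<bullet> a) \<cdot>\<^sub>v a) @\<^sub>v (d + (c \<bullet> b + d \<bullet> a) \<cdot>\<^sub>v b)"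
proof -
  have "a @\<^sub>v b \<in> carrier_vec (2 * n)" "c @\<^sub>v d \<in> carrier_vec (2 * n)"
    using assms by (simp_all add: mult_2)
  then show ?thesis
    using assms
    by (simp only: transvection_apply symp_form_append) (intro eq_vecI; auto)
qed

section \<open>Action on the stabilizer\<close>

lemma mult_mat_vec_fixed_on_span:
  fixes A :: "'a :: field mat"
  assumes A: "A \<in> carrier_mat m m" and S: "S \<subseteq> carrier_vec m"
    and fixed: "\<And>s. s \<in> S \<Longrightarrow> A *\<^sub>v s = s"
    and s: "s \<in> LinearCombinations.module.span class_ring (module_vec TYPE('a) m) S"
  shows "A *\<^sub>v s = s"
proof -
  interpret vec_space "TYPE('a)" m .
  \<comment> \<open>The fixed vectors form a subspace, so it contains the span of \<open>S\<close>
    once it contains \<open>S\<close>.\<close>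
  let ?N = "{v \<in> carrier_vec m. A *\<^sub>v v = v}"
  have "submodule class_ring ?N V"
    using A vec_module
    by (intro submodule.intro) (auto simp: module_vec_simps mult_add_distrib_mat_vec mult_mat_vec
        mult_mat_zero_vec[OF A])
  moreover have "S \<subseteq> ?N" using S fixed by auto
  ultimately show ?thesis using span_is_subset[of S ?N] s by auto
qed

lemma row_scalar_prod_mat_kernel:
  assumes "v \<in> mat_kernel H" "i < dim_row H"
  shows "row H i \<bullet> v = 0"
  using assms unfolding mat_kernel_def
  by (metis (mono_tags, lifting) index_mult_mat_vec index_zero_vec(1) mem_Collect_eq)

lemma stabilizer_fixed_transvection:
  assumes dims: "dim_col HX = n" "dim_col HZ = n"
    and a: "a \<in> mat_kernel HZ" and b: "b \<in> mat_kernel HX"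
    and s: "s \<in> stabilizer_vectors n HX HZ"
  shows "s v* transvection n (a @\<^sub>v b) = s"
  unfolding vec_mult_mat_def
proof (rule mult_mat_vec_fixed_on_span[OF _ _ _ s[unfolded stabilizer_vectors_def]])
  have ab: "a \<in> carrier_vec n" "b \<in> carrier_vec n"
    using a b dims unfolding mat_kernel_def by auto
  then show "(transvection n (a @\<^sub>v b))\<^sup>T \<in> carrier_mat (2 * n) (2 * n)"
    by (intro transpose_carrier_mat[THEN iffD2] transvection_carrier) (simp add: mult_2)
  have rows: "row HX i \<in> carrier_vec n" "row HZ i \<in> carrier_vec n" for i
    using dims by (simp_all add: carrier_vecI)
  then show "{row HX i @\<^sub>v 0\<^sub>v n | i. i < dim_row HX} \<union> {0\<^sub>v n @\<^sub>v row HZ i | i. i < dim_row HZ}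
      \<subseteq> carrier_vec (2 * n)"
    by (auto simp: mult_2)
  fix t
  assume "t \<in> {row HX i @\<^sub>v 0\<^sub>v n | i. i < dim_row HX} \<union> {0\<^sub>v n @\<^sub>v row HZ i | i. i < dim_row HZ}"
  \<comment> \<open>On a generator the coefficient is \<open>row HX i \<bullet> b\<close> or
    \<open>row HZ i \<bullet> a\<close>, which vanishes by the kernel assumptions.\<close>
  then have "t v* transvection n (a @\<^sub>v b) = t"
    using ab rows
    by (auto simp: transvection_apply_append row_scalar_prod_mat_kernel[OF a]
        row_scalar_prod_mat_kernel[OF b] zero_smult_vec[of _ n])
  then show "(transvection n (a @\<^sub>v b))\<^sup>T *\<^sub>v t = t" unfolding vec_mult_mat_def .
qed

lemma stabilizer_vectors_carrier:
  assumes "dim_col HX = n" "dim_col HZ = n" "s \<in> stabilizer_vectors n HX HZ"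
  shows "s \<in> carrier_vec (2 * n)"
proof -
  interpret vec_space "TYPE(bit)" "2 * n" .
  have "{row HX i @\<^sub>v 0\<^sub>v n | i. i < dim_row HX} \<union> {0\<^sub>v n @\<^sub>v row HZ i | i. i < dim_row HZ}
      \<subseteq> carrier_vec (2 * n)"
    using assms(1,2) by (auto simp: mult_2 carrier_vecI)
  then show ?thesis
    using span_closed[OF _ assms(3)[unfolded stabilizer_vectors_def]] by (simp only: module_vec_simps(3))
qed

section \<open>The logical gates\<close>

theorem corollary3p6:
  fixes n k :: nat
    and HX HZ :: "bit mat"
    and lX lZ :: "nat \<Rightarrow> bit vec"
  assumes "css_code n k HX HZ"
    and "logical_pauli_vectors n k HX HZ lX lZ"
  shows
    "(\<forall>i\<in>{1..k}.
        represents_gate n k HX HZ lX lZ (Phase i) (transvection n (0\<^sub>v n @\<^sub>v lZ i)))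
     \<and> (\<forall>i\<in>{1..k}.
        represents_gate n k HX HZ lX lZ (Hadamard i) (transvection n (lX i @\<^sub>v lZ i)))
     \<and> (\<forall>i\<in>{1..k}. \<forall>j\<in>{1..k}. i \<noteq> j \<longrightarrow>
        represents_gate n k HX HZ lX lZ (CNOT i j)
          (transvection n (lX j @\<^sub>v 0\<^sub>v n) * transvection n (lX j @\<^sub>v lZ i)
            * transvection n (0\<^sub>v n @\<^sub>v lZ i)))
     \<and> (\<forall>i\<in>{1..k}. \<forall>j\<in>{1..k}. i \<noteq> j \<longrightarrow>
        represents_gate n k HX HZ lX lZ (CZ i j)
          (transvection n (0\<^sub>v n @\<^sub>v lZ i) * transvection n (0\<^sub>v n @\<^sub>v (lZ i + lZ j))
            * transvection n (0\<^sub>v n @\<^sub>v lZ j)))"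
proof -
  have dims: "dim_col HX = n" "dim_col HZ = n"
    using assms(1) unfolding css_code_def by auto
  have kerX: "lX m \<in> mat_kernel HZ" and kerZ: "lZ m \<in> mat_kernel HX" if "m \<in> {1..k}" for m
    using assms(2) that unfolding logical_pauli_vectors_def represents_quotient_basis_def by auto
  have prod: "lX m \<bullet> lZ p = (if m = p then 1 else 0)" if "m \<in> {1..k}" "p \<in> {1..k}" for m p
    using assms(2) that unfolding logical_pauli_vectors_def by auto
  have carrier [simp]: "lX m \<in> carrier_vec n" "lZ m \<in> carrier_vec n" if "m \<in> {1..k}" for m
    using kerX[OF that] kerZ[OF that] dims unfolding mat_kernel_def by auto
  \<comment> \<open>The coefficient of a transvection contains products of Z-halves with X-halves,
    so the duality is needed in this order too.\<close>
  have prod': "lZ p \<bullet> lX m = (if m = p then 1 else 0)" if "m \<in> {1..k}" "p \<in> {1..k}" for m p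
    using prod[OF that] comm_scalar_prod[OF carrier(1)[OF that(1)] carrier(2)[OF that(2)]]
    by (simp only:)
  have H: "HX \<in> carrier_mat (dim_row HX) n" "HZ \<in> carrier_mat (dim_row HZ) n"
    by (rule carrier_matI[OF refl dims(1)], rule carrier_matI[OF refl dims(2)])
  \<comment> \<open>Covers the transvection vectors with one half equal to zero.\<close>
  have zero: "0\<^sub>v n \<in> mat_kernel HX" "0\<^sub>v n \<in> mat_kernel HZ"
    by (rule mat_kernelI[OF H(1) zero_carrier_vec mult_mat_zero_vec[OF H(1)]],
        rule mat_kernelI[OF H(2) zero_carrier_vec mult_mat_zero_vec[OF H(2)]])
  have kerZ_add: "lZ i + lZ j \<in> mat_kernel HX" if "i \<in> {1..k}" "j \<in> {1..k}" for i j
    using kerZ[OF that(1)] kerZ[OF that(2)]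
      mult_add_distrib_mat_vec[of HX "dim_row HX" "dim_col HX" "lZ i" "lZ j"]
    unfolding mat_kernel_def by simp
  \<comment> \<open>Kernel membership of the halves settles symplecticity and the stabilizer; only
    the action on the logical Paulis remains to be checked.\<close>
  have gate1: "represents_gate n k HX HZ lX lZ g (transvection n (a @\<^sub>v b))"
    if ab: "a \<in> mat_kernel HZ" "b \<in> mat_kernel HX"
      and act: "\<And>m. m \<in> {1..k} \<Longrightarrow>
        logical_X n lX m v* transvection n (a @\<^sub>v b) = gate_on_X g (logical_X n lX) (logical_Z n lZ) m \<and>
        logical_Z n lZ m v* transvection n (a @\<^sub>v b) = gate_on_Z g (logical_X n lX) (logical_Z n lZ) m"
    for g a b
  proof -
    have "a @\<^sub>v b \<in> carrier_vec (2 * n)"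
      using ab dims unfolding mat_kernel_def by (auto simp: mult_2)
    then show ?thesis
      unfolding represents_gate_def
      using transvection_in_Sp stabilizer_fixed_transvection[OF dims ab] act by blast
  qed
  \<comment> \<open>The same reduction for three factors, with the action split into successive
    transvections, leftmost first.\<close>
  have gate3: "represents_gate n k HX HZ lX lZ g
      (transvection n (a @\<^sub>v b) * transvection n (a' @\<^sub>v b') * transvection n (a'' @\<^sub>v b''))"
    if ker: "a \<in> mat_kernel HZ" "b \<in> mat_kernel HX" "a' \<in> mat_kernel HZ" "b' \<in> mat_kernel HX"
        "a'' \<in> mat_kernel HZ" "b'' \<in> mat_kernel HX"
      and act: "\<And>m. m \<in> {1..k} \<Longrightarrow>
        logical_X n lX m v* transvection n (a @\<^sub>v b) v* transvection n (a' @\<^sub>v b')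
          v* transvection n (a'' @\<^sub>v b'') = gate_on_X g (logical_X n lX) (logical_Z n lZ) m \<and>
        logical_Z n lZ m v* transvection n (a @\<^sub>v b) v* transvection n (a' @\<^sub>v b')
          v* transvection n (a'' @\<^sub>v b'') = gate_on_Z g (logical_X n lX) (logical_Z n lZ) m"
    for g a b a' b' a'' b''
  proof -
    have c: "a @\<^sub>v b \<in> carrier_vec (2 * n)" "a' @\<^sub>v b' \<in> carrier_vec (2 * n)"
      "a'' @\<^sub>v b'' \<in> carrier_vec (2 * n)"
      using ker dims unfolding mat_kernel_def by (auto simp: mult_2)
    have T: "y v* (transvection n (a @\<^sub>v b) * transvection n (a' @\<^sub>v b') * transvection n (a'' @\<^sub>v b''))
        = y v* transvection n (a @\<^sub>v b) v* transvection n (a' @\<^sub>v b') v* transvection n (a'' @\<^sub>v b'')"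
      if "y \<in> carrier_vec (2 * n)" for y
      using c[THEN transvection_carrier] that
      by (simp add: vec_mult_mat_times[of _ "2 * n"] vec_mult_mat_carrier[of _ "2 * n" "2 * n"])
    have "logical_X n lX m \<in> carrier_vec (2 * n)" "logical_Z n lZ m \<in> carrier_vec (2 * n)"
      if "m \<in> {1..k}" for m
      using that by (simp_all add: logical_X_def logical_Z_def mult_2)
    moreover have "s v* (transvection n (a @\<^sub>v b) * transvection n (a' @\<^sub>v b')
        * transvection n (a'' @\<^sub>v b'')) = s" if "s \<in> stabilizer_vectors n HX HZ" for s
      using that ker
      by (simp only: T stabilizer_vectors_carrier[OF dims] stabilizer_fixed_transvection[OF dims])
    moreover have "transvection n (a @\<^sub>v b) * transvection n (a' @\<^sub>v b')
        * transvection n (a'' @\<^sub>v b'') \<in> Sp n"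
      using c by (intro Sp_mult transvection_in_Sp)
    ultimately show ?thesis
      unfolding represents_gate_def using act by (auto simp only: T)
  qed
  note act = logical_X_def logical_Z_def transvection_apply_append append_vec_add[of _ n _ _ n]
    zero_smult_vec[of _ n] prod prod' kerX kerZ zero kerZ_add
    scalar_prod_add_distrib[of _ n] add_scalar_prod_distrib[of _ n]
    bit_vec_add_self[of _ n] bit_vec_add_self_right[of _ n]
  have phase: "represents_gate n k HX HZ lX lZ (Phase i) (transvection n (0\<^sub>v n @\<^sub>v lZ i))"
    if "i \<in> {1..k}" for i
    using that by (intro gate1) (auto simp: act)
  \<comment> \<open>Both vectors of pair \<open>i\<close> have coefficient 1; adding
    \<open>[lX i, lZ i]\<close> cancels the half present and creates the other.\<close>
  have hadamard: "represents_gate n k HX HZ lX lZ (Hadamard i) (transvection n (lX i @\<^sub>v lZ i))"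
    if "i \<in> {1..k}" for i
    using that by (intro gate1) (auto simp: act)
  \<comment> \<open>Successive images: \<open>[lX i, 0]\<close> stays, then becomes
    \<open>[lX i + lX j, lZ i]\<close>, then \<open>[lX i + lX j, 0]\<close>;
    \<open>[0, lZ j]\<close> becomes \<open>[lX j, lZ j]\<close>, then
    \<open>[0, lZ j + lZ i]\<close>, and stays. Commutativity restores the order of the last
    sum.\<close>
  have cnot: "represents_gate n k HX HZ lX lZ (CNOT i j)
      (transvection n (lX j @\<^sub>v 0\<^sub>v n) * transvection n (lX j @\<^sub>v lZ i)
        * transvection n (0\<^sub>v n @\<^sub>v lZ i))"
    if "i \<in> {1..k}" "j \<in> {1..k}" "i \<noteq> j" for i j
    using that by (intro gate3) (auto simp: act comm_add_vec[of _ n "lZ j"])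
  \<comment> \<open>All three vectors have zero X-half, so the logical Z vectors stay fixed. The
    Z-half of X \<open>i\<close> collects \<open>lZ i\<close> and \<open>lZ i + lZ j\<close>, that
    of X \<open>j\<close> collects \<open>lZ i + lZ j\<close> and \<open>lZ j\<close>; the repeated
    summand cancels.\<close>
  have cz: "represents_gate n k HX HZ lX lZ (CZ i j)
      (transvection n (0\<^sub>v n @\<^sub>v lZ i) * transvection n (0\<^sub>v n @\<^sub>v (lZ i + lZ j))
        * transvection n (0\<^sub>v n @\<^sub>v lZ j))"
    if "i \<in> {1..k}" "j \<in> {1..k}" "i \<noteq> j" for i j
    using that by (intro gate3) (auto simp: act)
  show ?thesis using phase hadamard cnot cz by blast
qed

end
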